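(* Let $K \subset \mathbb{R}^2$ be a convex set that is a universal cover for planar arcs of unit length. Then the area of $K$ is at least $0.227498$.
   Context: A set $K \subset \mathbb{R}^2$ is a universal cover for planar arcs of unit length if, for every rectifiable planar arc of length $1$, $K$ contains a congruent copy of that arc (its image under some isometry of the plane). *)

theory Defs
  imports "HOL-Analysis.Analysis"
begin

(* Lengths of the polygonal lines inscribed in g, over all finite subdivisions of
   (part of) the parameter interval {0..1}; repeated subdivision points are harmless. *)
definition inscribed_lengths :: "(real \<Rightarrow> 'a::metric_space) \<Rightarrow> real set" where
  "inscribed_lengths g =
     {\<Sum>i<n. dist (g (t i)) (g (t (Suc i))) | (n::nat) (t::nat \<Rightarrow> real).
        mono_on {..n} t \<and> t ` {..n} \<subseteq> {0..1}}"

definition rectifiable :: "(real \<Rightarrow> 'a::metric_space) \<Rightarrow> bool" where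
  "rectifiable g \<longleftrightarrow> path g \<and> bdd_above (inscribed_lengths g)"

(* Meaningful only for rectifiable g. *)
definition path_length :: "(real \<Rightarrow> 'a::metric_space) \<Rightarrow> real" where
  "path_length g = Sup (inscribed_lengths g)"

(* On Euclidean space such a map is automatically onto; reflections are included. *)
definition isometry :: "('a::metric_space \<Rightarrow> 'a) \<Rightarrow> bool" where
  "isometry f \<longleftrightarrow> (\<forall>x y. dist (f x) (f y) = dist x y)"

(* An arc (Path_Connected) is an injective path. Requiring only the simple arcs to be covered
   is the weaker demand on K: a set covering all paths of unit length, including closed or
   self-intersecting ones, is in particular a universal cover in this sense. *)
definition universal_cover :: "(real^2) set \<Rightarrow> bool" where
  "universal_cover K \<longleftrightarrow>
     (\<forall>g :: real \<Rightarrow> real^2. arc g \<and> rectifiable g \<and> path_length g = 1 \<longrightarrow>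
        (\<exists>f. isometry f \<and> f ` path_image g \<subseteq> K))"

end

theory Submission
  imports Defs
begin

text \<open>
  A convex universal cover \<open>K\<close> contains, up to isometry, a unit segment \<open>L\<close>, an equilateral triangle
  \<open>T\<close> with sides \<open>1/2\<close> (the hull of an arc with two sides), and a rectangle \<open>R\<close> with sides \<open>1/2\<close>
  and \<open>1/4\<close> (the hull of an arc with three sides). These three sets alone enforce the bound.

  The tool is the inequality \<open>area K \<ge> (a * h + b * w) / 2\<close>, where \<open>K\<close> contains a rectangle with
  sides \<open>a\<close>, \<open>b\<close> and has extents \<open>w\<close>, \<open>h\<close> parallel to them (lemma \<open>mixed_area_bound\<close>). It does
  not depend on the relative position of the three sets, only on their directions, and
  it is used for \<open>R\<close> and for \<open>L\<close>, the latter as a rectangle with \<open>b = 0\<close>.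

  Suppose that the area is less than \<open>0.227498\<close>. The inequality for \<open>L\<close> bounds the extent of \<open>T\<close>
  orthogonal to \<open>L\<close> by \<open>0.455\<close>, which is close to the altitude of \<open>T\<close>, about \<open>0.433\<close>. Hence one side of \<open>T\<close>
  is nearly parallel to \<open>L\<close> (lemma \<open>equilateral_min_le\<close>), and up to this small tilt only the angle \<open>\<theta>\<close> between
  \<open>L\<close> and the longer side of \<open>R\<close> remains free. The inequality for \<open>R\<close> then demands
  \<open>2 * h + w < 1.82\<close>, where \<open>w \<ge> cos \<theta>\<close>, \<open>h \<ge> sin \<theta>\<close>, and \<open>h\<close> is also at least the extent of \<open>T\<close>.
  This is impossible for every \<open>\<theta>\<close> (lemma \<open>segment_and_aligned_triangle_not_narrow\<close>).
\<close>

section \<open>Orthonormal frames and triangles in the plane\<close>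

text \<open>
  An orthonormal pair in the plane is determined by its first member up to the
  orientation \<open>k = \<plusminus>1\<close>; polynomial identities about such pairs then reduce to one vector.
\<close>

lemma orthonormal_pair_vec2:
  fixes u v :: "real^2"
  assumes "u \<bullet> u = 1" "v \<bullet> v = 1" "u \<bullet> v = 0"
  obtains k where "k\<^sup>2 = 1" "v $ 1 = - k * u $ 2" "v $ 2 = k * u $ 1"
proof
  let ?k = "u$1 * v$2 - u$2 * v$1"
  have a: "u$1 * u$1 + u$2 * u$2 = 1" "v$1 * v$1 + v$2 * v$2 = 1" "u$1 * v$1 + u$2 * v$2 = 0"
    using assms by (simp_all add: inner_vec_def sum_2)
  show "?k\<^sup>2 = 1" using a unfolding power2_eq_square by algebra
  show "v $ 1 = - ?k * u $ 2" using a by algebra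
  show "v $ 2 = ?k * u $ 1" using a by algebra
qed

text \<open>
  Parseval's identity for an orthonormal basis of the plane. It allows working in the frame
  of an object inside the cover instead of moving that object to a standard position.
\<close>

lemma inner_orthonormal_pair:
  fixes u v x y :: "real^2"
  assumes "u \<bullet> u = 1" "v \<bullet> v = 1" "u \<bullet> v = 0"
  shows "x \<bullet> y = (x \<bullet> u) * (y \<bullet> u) + (x \<bullet> v) * (y \<bullet> v)"
proof -
  obtain k where k: "k\<^sup>2 = 1" "v $ 1 = - k * u $ 2" "v $ 2 = k * u $ 1"
    using orthonormal_pair_vec2[OF assms] .
  have "u$1 * u$1 + u$2 * u$2 = 1"
    using assms by (simp add: inner_vec_def sum_2)
  with k show ?thesis
    unfolding inner_vec_def sum_2 inner_real_def power2_eq_square by algebra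
qed

lemma measure_triangle_over_edge:
  fixes u v C D X :: "real^2"
  assumes uv: "u \<bullet> u = 1" "v \<bullet> v = 1" "u \<bullet> v = 0" and D: "D = C + s *\<^sub>R u"
  shows "measure lebesgue (convex hull {C, D, X}) = \<bar>s\<bar> * \<bar>(X - C) \<bullet> v\<bar> / 2"
proof -
  obtain k where k: "k\<^sup>2 = 1" "v $ 1 = - k * u $ 2" "v $ 2 = k * u $ 1"
    using orthonormal_pair_vec2[OF uv] .
  have "\<bar>k\<bar> = 1" using k(1) by (auto simp: power2_eq_1_iff)
  have "compact (convex hull {C, D, X})"
    by (intro finite_imp_compact_convex_hull) auto
  then have "measure lebesgue (convex hull {C, D, X}) = measure lborel (convex hull {C, D, X})"
    by (intro measure_completion) (auto dest: compact_imp_closed)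
  also have "\<dots> = \<bar>(X $ 1 - C $ 1) * (s * u $ 2) - (s * u $ 1) * (X $ 2 - C $ 2)\<bar> / 2"
    by (simp add: content_triangle D)
  also have "(X $ 1 - C $ 1) * (s * u $ 2) - (s * u $ 1) * (X $ 2 - C $ 2)
      = - (k * s * ((X - C) \<bullet> v))"
    using k by (simp add: inner_vec_def sum_2 power2_eq_square) algebra
  finally show ?thesis using \<open>\<bar>k\<bar> = 1\<close> by (simp add: abs_mult)
qed

lemma negligible_hulls_separated:
  fixes n :: "'a::euclidean_space"
  assumes "n \<noteq> 0" "\<And>x. x \<in> A \<Longrightarrow> n \<bullet> x \<le> c" "\<And>x. x \<in> B \<Longrightarrow> c \<le> n \<bullet> x"
  shows "negligible (convex hull A \<inter> convex hull B)"
proof (rule negligible_subset)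
  show "negligible {x. n \<bullet> x = c}" using assms(1) by (simp add: negligible_hyperplane)
  have "convex hull A \<subseteq> {x. n \<bullet> x \<le> c}"
    using assms by (intro hull_minimal) (auto simp: convex_halfspace_le)
  moreover have "convex hull B \<subseteq> {x. n \<bullet> x \<ge> c}"
    using assms by (intro hull_minimal) (auto simp: convex_halfspace_ge)
  ultimately show "convex hull A \<inter> convex hull B \<subseteq> {x. n \<bullet> x = c}" by force
qed

text \<open>
  Two triangles erected over the edges of a rectangle that meet at the corner \<open>C\<close> can overlap
  only on a line if the apex over the edge normal to \<open>v\<close> is the farther one in direction \<open>v\<close>
  and the apex over the edge normal to \<open>u\<close> is the farther one in direction \<open>u\<close>: seen from
  \<open>C\<close>, the first apex \<open>X\<close> then lies on the steeper side, so that either the line through \<open>C\<close> and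
  \<open>X\<close> or the line supporting the second edge separates them.
\<close>

lemma negligible_corner_triangles:
  fixes u v C D E X Z :: "'a::euclidean_space"
  assumes uv: "u \<bullet> u = 1" "v \<bullet> v = 1" "u \<bullet> v = 0"
    and D: "D = C - a *\<^sub>R u" "0 \<le> a" and E: "E = C - b *\<^sub>R v" "0 \<le> b"
    and XZ: "C \<bullet> v \<le> X \<bullet> v" "C \<bullet> u \<le> Z \<bullet> u" "X \<bullet> u \<le> Z \<bullet> u" "Z \<bullet> v \<le> X \<bullet> v"
  shows "negligible (convex hull {C, D, X} \<inter> convex hull {C, E, Z})"
proof (cases "X \<bullet> u \<le> C \<bullet> u")
  case True
  show ?thesis
    by (rule negligible_hulls_separated[where n=u and c="u \<bullet> C"])
       (use uv D E XZ True in \<open>auto simp: inner_diff inner_commute\<close>)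
next
  case False
  define n where "n = ((X - C) \<bullet> v) *\<^sub>R u - ((X - C) \<bullet> u) *\<^sub>R v"
  have vu: "v \<bullet> u = 0" using uv by (simp add: inner_commute)
  have p: "(X - C) \<bullet> u > 0" using False by (simp add: inner_diff)
  have q: "(X - C) \<bullet> v \<ge> 0" using XZ by (simp add: inner_diff)
  have "n \<bullet> v = - ((X - C) \<bullet> u)" by (simp add: n_def inner_diff uv)
  then have "n \<noteq> 0" using p by auto
  moreover have "n \<bullet> (X - C) = 0" by (simp add: n_def inner_diff inner_commute algebra_simps)
  moreover have "n \<bullet> (D - C) \<le> 0" using q D by (simp add: n_def inner_diff uv vu)
  moreover have "n \<bullet> (E - C) \<ge> 0" 
    using mult_nonneg_nonneg[OF E(2) less_imp_le[OF p]] \<open>n \<bullet> v = - ((X - C) \<bullet> u)\<close> by (simp add: E(1))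
  moreover have "n \<bullet> (Z - C) \<ge> 0"
  proof -
    have "((X - C) \<bullet> u) * ((Z - C) \<bullet> v) \<le> ((X - C) \<bullet> u) * ((X - C) \<bullet> v)"
      using p XZ by (intro mult_left_mono) (auto simp: inner_diff)
    also have "\<dots> \<le> ((Z - C) \<bullet> u) * ((X - C) \<bullet> v)"
      using q XZ by (intro mult_right_mono) (auto simp: inner_diff)
    finally show ?thesis by (simp add: n_def inner_diff inner_commute algebra_simps)
  qed
  ultimately show ?thesis
    by (intro negligible_hulls_separated[where n=n and c="n \<bullet> C"]) (auto simp: inner_diff_right)
qed

section \<open>A mixed area inequality for rectangles\<close>

lemma measure_Un_negligible_Int:
  assumes "A \<in> lmeasurable" "B \<in> lmeasurable" "negligible (A \<inter> B)"
  shows "measure lebesgue (A \<union> B) = measure lebesgue A + measure lebesgue B"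
  using assms by (simp add: measure_Un3 negligible_imp_measure0)

lemma lmeasurable_convex_hull_finite:
  fixes F :: "'a::euclidean_space set"
  shows "finite F \<Longrightarrow> convex hull F \<in> lmeasurable"
  by (simp add: lmeasurable_compact finite_imp_compact_convex_hull)

text \<open>
  For a convex set \<open>K\<close> containing the rectangle \<open>R\<close>, the right-hand side of
  \<open>area K \<ge> (a * h + b * w) / 2\<close>, with \<open>w\<close> and \<open>h\<close> the extents of \<open>K\<close> along the sides of
  \<open>R\<close>, is the mixed area of \<open>K\<close> and \<open>R\<close>, and mixed area is monotone. Concretely, the hull
  contains, besides \<open>R\<close>, a triangle over each edge of \<open>R\<close> whose apex is an extremal point in the
  direction of the outer normal. The five pieces overlap only in null sets, and the area of each
  triangle depends only on the height of its apex above the edge. The case \<open>b = 0\<close>, in which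
  \<open>R\<close> is a segment, is used as well.
\<close>

lemma mixed_area_bound:
  fixes u v P :: "real^2"
  assumes uv: "u \<bullet> u = 1" "v \<bullet> v = 1" "u \<bullet> v = 0"
    and ab: "0 \<le> a" "0 \<le> b" and F: "finite F"
    and rect: "P \<in> F" "P + a *\<^sub>R u \<in> F" "P + b *\<^sub>R v \<in> F" "P + a *\<^sub>R u + b *\<^sub>R v \<in> F"
    and xyzw: "x \<in> F" "y \<in> F" "z \<in> F" "w \<in> F"
  shows "a * ((x - y) \<bullet> v) + b * ((z - w) \<bullet> u) \<le> 2 * measure lebesgue (convex hull F)"
proof -
  have vu: "v \<bullet> u = 0" using uv by (simp add: inner_commute)
  have F0: "F \<noteq> {}" using rect by auto
  have top: "\<exists>X\<in>F. \<forall>p\<in>F. p \<bullet> d \<le> X \<bullet> d" for d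
    using obtains_MAX[OF F F0, of "\<lambda>p. p \<bullet> d"] F by (metis Max_ge finite_imageI imageI)
  obtain T R where T: "T \<in> F" "\<And>p. p \<in> F \<Longrightarrow> p \<bullet> v \<le> T \<bullet> v"
    and R: "R \<in> F" "\<And>p. p \<in> F \<Longrightarrow> p \<bullet> u \<le> R \<bullet> u"
    using top by metis
  obtain B L where B: "B \<in> F" "\<And>p. p \<in> F \<Longrightarrow> B \<bullet> v \<le> p \<bullet> v"
    and L: "L \<in> F" "\<And>p. p \<in> F \<Longrightarrow> L \<bullet> u \<le> p \<bullet> u"
    using top[of "- v"] top[of "- u"] by auto
  define Q where "Q = P + a *\<^sub>R u"
  define S where "S = P + b *\<^sub>R v"
  define C where "C = P + a *\<^sub>R u + b *\<^sub>R v"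
  note defs = Q_def S_def C_def
  have pts: "P \<in> F" "Q \<in> F" "S \<in> F" "C \<in> F" using rect by (simp_all add: defs)
  have cu: "Q \<bullet> u = P \<bullet> u + a" "S \<bullet> u = P \<bullet> u" "C \<bullet> u = P \<bullet> u + a"
    and cv: "Q \<bullet> v = P \<bullet> v" "S \<bullet> v = P \<bullet> v + b" "C \<bullet> v = P \<bullet> v + b"
    by (simp_all add: defs inner_add uv vu)
  note cuv = cu cv cu[simplified inner_commute[of _ u]] cv[simplified inner_commute[of _ v]]
  have u0: "u \<noteq> 0" "v \<noteq> 0" using uv by auto
  define R1 R2 where "R1 = convex hull {P, Q, C}" and "R2 = convex hull {P, S, C}"
  define Tt Tb where "Tt = convex hull {C, S, T}" and "Tb = convex hull {P, Q, B}"
  define Tr Tl where "Tr = convex hull {C, Q, R}" and "Tl = convex hull {P, S, L}"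
  note pieces = R1_def R2_def Tt_def Tb_def Tr_def Tl_def
  have hu: "negligible (convex hull {A1,A2,A3} \<inter> convex hull {B1,B2,B3})"
    if "max (A1 \<bullet> u) (max (A2 \<bullet> u) (A3 \<bullet> u)) \<le> min (B1 \<bullet> u) (min (B2 \<bullet> u) (B3 \<bullet> u))" for A1 A2 A3 B1 B2 B3
    by (rule negligible_hulls_separated[where n=u and c="max (A1 \<bullet> u) (max (A2 \<bullet> u) (A3 \<bullet> u))"])
      (use that u0 in \<open>auto simp: inner_commute\<close>)
  have hv: "negligible (convex hull {A1,A2,A3} \<inter> convex hull {B1,B2,B3})"
    if "max (A1 \<bullet> v) (max (A2 \<bullet> v) (A3 \<bullet> v)) \<le> min (B1 \<bullet> v) (min (B2 \<bullet> v) (B3 \<bullet> v))" for A1 A2 A3 B1 B2 B3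
    by (rule negligible_hulls_separated[where n=v and c="max (A1 \<bullet> v) (max (A2 \<bullet> v) (A3 \<bullet> v))"])
      (use that u0 in \<open>auto simp: inner_commute\<close>)
  have Tv: "P \<bullet> v + b \<le> T \<bullet> v" "B \<bullet> v \<le> P \<bullet> v" "P \<bullet> u + a \<le> R \<bullet> u" "L \<bullet> u \<le> P \<bullet> u"
    using T(2)[OF pts(4)] B(2)[OF pts(1)] R(2)[OF pts(4)] L(2)[OF pts(1)] by (simp_all add: cuv)
  \<comment> \<open>The rectangle is cut along a diagonal into two triangles. The pieces are separated by lines
    parallel to its sides, except for this pair and for the pairs meeting at a corner.\<close>
  have neg_rect: "negligible (R1 \<inter> R2)"
  proof (cases "a = 0")
    case True
    then show ?thesis unfolding pieces by (intro hu) (simp add: cuv)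
  next
    case False
    define n where "n = a *\<^sub>R v - b *\<^sub>R u"
    have "n \<bullet> v = a" by (simp add: n_def inner_diff uv)
    then have "n \<noteq> 0" using False by auto
    moreover have "n \<bullet> Q \<le> n \<bullet> P" "n \<bullet> P \<le> n \<bullet> S" "n \<bullet> C = n \<bullet> P"
      using ab by (auto simp: n_def inner_diff cuv algebra_simps)
    ultimately show ?thesis unfolding pieces
      by (intro negligible_hulls_separated[where n=n and c="n \<bullet> P"]) auto
  qed
  have neg_u: "negligible (R1 \<inter> Tr)" "negligible (R2 \<inter> Tr)" "negligible (Tl \<inter> R1)" "negligible (Tl \<inter> R2)" "negligible (Tl \<inter> Tr)"
    unfolding pieces using Tv ab by (auto intro!: hu simp: cuv)
  have neg_v: "negligible (R1 \<inter> Tt)" "negligible (R2 \<inter> Tt)" "negligible (Tb \<inter> R1)" "negligible (Tb \<inter> R2)" "negligible (Tb \<inter> Tt)"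
    unfolding pieces using Tv ab by (auto intro!: hv simp: cuv)
  have neg_TR: "negligible (Tt \<inter> Tr)"
    unfolding pieces
    by (rule negligible_corner_triangles[where u=u and v=v and a=a and b=b])
       (use uv ab T R Tv in \<open>auto simp: cuv\<close>, auto simp: defs)
  have neg_TL: "negligible (Tt \<inter> Tl)"
    unfolding pieces insert_commute[of C S]  insert_commute[of P S]
    by (rule negligible_corner_triangles[where u="-u" and v=v and a=a and b=b])
       (use uv ab T L Tv in \<open>auto simp: cuv\<close>, auto simp: defs)
  have neg_BR: "negligible (Tb \<inter> Tr)"
    unfolding pieces insert_commute[of C Q]  insert_commute[of P Q]
    by (rule negligible_corner_triangles[where u=u and v="-v" and a=a and b=b])
       (use uv ab B R Tv in \<open>auto simp: cuv\<close>, auto simp: defs)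
  have neg_BL: "negligible (Tb \<inter> Tl)"
    unfolding pieces 
    by (rule negligible_corner_triangles[where u="-u" and v="-v" and a=a and b=b])
       (use uv ab B L Tv in \<open>auto simp: cuv\<close>, auto simp: defs)
  note negs = neg_rect neg_u neg_v neg_TR neg_TL neg_BR neg_BL
  have meas: "R1 \<in> lmeasurable" "R2 \<in> lmeasurable" "Tt \<in> lmeasurable" "Tb \<in> lmeasurable"
     "Tr \<in> lmeasurable" "Tl \<in> lmeasurable"
    unfolding pieces by (simp_all add: lmeasurable_convex_hull_finite)
  let ?m = "measure lebesgue"
  have "?m (R1 \<union> R2 \<union> Tt \<union> Tb \<union> Tr \<union> Tl) = ?m R1 + ?m R2 + ?m Tt + ?m Tb + ?m Tr + ?m Tl"
    using meas negs negs[simplified Int_commute]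
    by (simp add: measure_Un_negligible_Int fmeasurable.Un Int_Un_distrib Int_Un_distrib2 negligible_Un_eq Int_commute)
  moreover have "?m (R1 \<union> R2 \<union> Tt \<union> Tb \<union> Tr \<union> Tl) \<le> ?m (convex hull F)"
  proof (rule measure_mono_fmeasurable)
    show "R1 \<union> R2 \<union> Tt \<union> Tb \<union> Tr \<union> Tl \<subseteq> convex hull F"
      unfolding pieces using pts T R B L by (intro Un_least hull_mono) auto
  qed (use meas F in \<open>auto intro: lmeasurable_convex_hull_finite\<close>)
  moreover have "?m R1 = a * b / 2" 
    unfolding pieces by (subst measure_triangle_over_edge[OF uv Q_def]) (use ab in \<open>simp add: inner_diff cuv\<close>)
  moreover have "?m R2 = a * b / 2" 
    unfolding pieces by (subst measure_triangle_over_edge[OF uv(2,1) vu S_def]) (use ab in \<open>simp add: inner_diff cuv\<close>)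
  moreover have "?m Tt = a * (T \<bullet> v - P \<bullet> v - b) / 2"
    unfolding pieces by (subst measure_triangle_over_edge[OF uv, where s="-a"]) (use ab Tv in \<open>auto simp add: inner_diff cuv\<close>, simp add: defs)
  moreover have "?m Tb = a * (P \<bullet> v - B \<bullet> v) / 2"
    unfolding pieces by (subst measure_triangle_over_edge[OF uv Q_def]) (use ab Tv in \<open>auto simp add: inner_diff cuv\<close>)
  moreover have "?m Tr = b * (R \<bullet> u - P \<bullet> u - a) / 2"
    unfolding pieces by (subst measure_triangle_over_edge[OF uv(2,1) vu, where s="-b"]) (use ab Tv in \<open>auto simp add: inner_diff cuv\<close>, simp add: defs)
  moreover have "?m Tl = b * (P \<bullet> u - L \<bullet> u) / 2"
    unfolding pieces by (subst measure_triangle_over_edge[OF uv(2,1) vu S_def]) (use ab Tv in \<open>auto simp add: inner_diff cuv\<close>)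
  ultimately have "a * (T \<bullet> v - B \<bullet> v) + b * (R \<bullet> u - L \<bullet> u) \<le> 2 * ?m (convex hull F)"
    by (simp add: field_simps)
  moreover have "(x - y) \<bullet> v \<le> T \<bullet> v - B \<bullet> v"
    using T(2)[OF xyzw(1)] B(2)[OF xyzw(2)] by (simp add: inner_diff)
  then have "a * ((x - y) \<bullet> v) \<le> a * (T \<bullet> v - B \<bullet> v)" using ab by (intro mult_left_mono)
  moreover have "(z - w) \<bullet> u \<le> R \<bullet> u - L \<bullet> u"
    using R(2)[OF xyzw(3)] L(2)[OF xyzw(4)] by (simp add: inner_diff)
  then have "b * ((z - w) \<bullet> u) \<le> b * (R \<bullet> u - L \<bullet> u)" using ab by (intro mult_left_mono)
  ultimately show ?thesis by linarith
qed

section \<open>Isometries and measurability of convex sets\<close>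

text \<open>
  By polarization, inner products of difference vectors are expressed by distances. This makes it
  unnecessary to know that isometries are affine.
\<close>

lemma isometry_inner_diff:
  fixes f :: "'a::real_inner \<Rightarrow> 'a"
  assumes "isometry f"
  shows "(f x - f y) \<bullet> (f z - f w) = (x - y) \<bullet> (z - w)"
proof -
  have polar: "(p - q) \<bullet> (r - s) = ((dist p s)\<^sup>2 + (dist q r)\<^sup>2 - (dist p r)\<^sup>2 - (dist q s)\<^sup>2) / 2"
    for p q r s :: 'a
    by (simp add: dist_norm power2_norm_eq_inner inner_diff inner_commute algebra_simps)
  show ?thesis using assms unfolding isometry_def polar by simp
qed

text \<open>
  A convex set differs from its closure by a subset of its frontier, which is a null set.
\<close>

lemma convex_imp_sets_lebesgue:
  fixes K :: "'a::euclidean_space set"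
  assumes "convex K"
  shows "K \<in> sets lebesgue"
proof (rule sets_negligible_symdiff[where S="closure K"])
  show "negligible (closure K - K \<union> (K - closure K))"
    using negligible_convex_frontier[OF assms]
    by (rule negligible_subset) (use closure_subset interior_subset in \<open>auto simp: frontier_def\<close>)
qed simp

lemma emeasure_convex_ge_hull:
  fixes K :: "'a::euclidean_space set"
  assumes "convex K" "finite F" "F \<subseteq> K"
  shows "ennreal (measure lebesgue (convex hull F)) \<le> emeasure lebesgue K"
proof -
  have "ennreal (measure lebesgue (convex hull F)) = emeasure lebesgue (convex hull F)"
    using lmeasurable_convex_hull_finite[OF assms(2)] by (simp add: emeasure_eq_measure2)
  also have "\<dots> \<le> emeasure lebesgue K"
    using assms by (intro emeasure_mono convex_imp_sets_lebesgue hull_minimal)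
  finally show ?thesis .
qed

section \<open>Three unit arcs in a universal cover\<close>

lemma dist_vec2_le:
  fixes p q :: "real^2"
  assumes "(p$1 - q$1)\<^sup>2 + (p$2 - q$2)\<^sup>2 \<le> d\<^sup>2" "0 \<le> d"
  shows "dist p q \<le> d"
  using assms by (simp add: dist_vec_def L2_set_def sum_2 dist_real_def real_le_lsqrt)

lemma inscribed_sum_le:
  fixes g :: "real \<Rightarrow> 'a::metric_space"
  assumes lip: "\<And>s t. 0 \<le> s \<Longrightarrow> s \<le> t \<Longrightarrow> t \<le> 1 \<Longrightarrow> dist (g s) (g t) \<le> t - s"
    and t: "mono_on {..n} t" "t ` {..n} \<subseteq> {0..1}"
  shows "(\<Sum>i<n. dist (g (t i)) (g (t (Suc i)))) \<le> 1"
proof -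
  have "dist (g (t i)) (g (t (Suc i))) \<le> t (Suc i) - t i" if "i < n" for i
    using that t by (intro lip) (auto simp: mono_on_def image_subset_iff)
  then have "(\<Sum>i<n. dist (g (t i)) (g (t (Suc i)))) \<le> (\<Sum>i<n. t (Suc i) - t i)"
    by (intro sum_mono) auto
  also have "\<dots> = t n - t 0" by (rule sum_lessThan_telescope)
  also have "\<dots> \<le> 1"
  proof -
    have "t n \<in> {0..1}" "t 0 \<in> {0..1}" using t(2) by auto
    then show ?thesis by auto
  qed
  finally show ?thesis .
qed

text \<open>
  For a curve that does not increase distances, every inscribed polygonal line has length at most that of
  the parameter interval, so a single subdivision of total length 1, namely at the corners of a
  polygonal curve run through at unit speed, already determines the length.
\<close>

lemma universal_cover_contains_unit_speed_arc:
  fixes g :: "real \<Rightarrow> real^2"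
  assumes K: "universal_cover K"
    and lip: "\<And>s t. 0 \<le> s \<Longrightarrow> s \<le> t \<Longrightarrow> t \<le> 1 \<Longrightarrow> dist (g s) (g t) \<le> t - s"
    and inj: "\<And>s t. 0 \<le> s \<Longrightarrow> s < t \<Longrightarrow> t \<le> 1 \<Longrightarrow> g s \<noteq> g t"
    and corners: "mono_on {..n} c" "c ` {..n} \<subseteq> {0..1}"
      "(\<Sum>i<n. dist (g (c i)) (g (c (Suc i)))) = 1"
  obtains f where "isometry f" "\<And>t. 0 \<le> t \<Longrightarrow> t \<le> 1 \<Longrightarrow> f (g t) \<in> K"
proof -
  have lip': "dist (g s) (g t) \<le> 1 * dist s t" if "s \<in> {0..1}" "t \<in> {0..1}" for s t
    using that lip[of s t] lip[of t s] by (cases "s \<le> t") (auto simp: dist_commute dist_real_def)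
  then have "path g"
    unfolding path_def by (intro lipschitz_on_continuous_on[of 1]) (auto simp: lipschitz_on_def)
  moreover have "inj_on g {0..1}"
  proof (rule inj_onI)
    fix s t :: real
    assume "s \<in> {0..1}" "t \<in> {0..1}" "g s = g t"
    then show "s = t" using inj[of s t] inj[of t s] by (cases s t rule: linorder_cases) auto
  qed
  ultimately have "arc g" by (simp add: arc_def)
  have le: "x \<le> 1" if "x \<in> inscribed_lengths g" for x
    using that inscribed_sum_le[OF lip] by (auto simp: inscribed_lengths_def)
  have "1 \<in> inscribed_lengths g"
    unfolding inscribed_lengths_def
    by (intro CollectI exI[of _ n] exI[of _ c]) (simp add: corners)
  with le have "path_length g = 1"
    unfolding path_length_def by (intro cSup_eq_maximum)
  moreover have "rectifiable g"
    using \<open>path g\<close> le by (auto simp: rectifiable_def bdd_above_def)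
  ultimately obtain f where "isometry f" "f ` path_image g \<subseteq> K"
    using K \<open>arc g\<close> unfolding universal_cover_def by blast
  then show ?thesis by (intro that[of f]) (auto simp: path_image_def)
qed

lemma universal_cover_contains_segment:
  assumes "universal_cover K"
  obtains A B where "A \<in> K" "B \<in> K" "(B - A) \<bullet> (B - A) = 1"
proof -
  define g :: "real \<Rightarrow> real^2" where "g t = vector [t, 0]" for t
  obtain f where f: "isometry f" "\<And>t. 0 \<le> t \<Longrightarrow> t \<le> 1 \<Longrightarrow> f (g t) \<in> K"
  proof (rule universal_cover_contains_unit_speed_arc[OF assms, of g 1 real])
    show "dist (g s) (g t) \<le> t - s" if "s \<le> t" for s t
      using that by (intro dist_vec2_le) (auto simp: g_def power2_commute)
    show "g s \<noteq> g t" if "s < t" for s t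
      using that by (auto simp: g_def vec_eq_iff forall_2)
  qed (auto simp: g_def dist_vec_def L2_set_def sum_2 dist_real_def mono_on_def)
  have "(f (g 1) - f (g 0)) \<bullet> (f (g 1) - f (g 0)) = 1"
    unfolding isometry_inner_diff[OF f(1)] by (simp add: g_def inner_vec_def sum_2)
  then show ?thesis using f by (intro that[of "f (g 0)" "f (g 1)"]) auto
qed

text \<open>
  The arc consists of two sides of length \<open>1/2\<close> at an angle of 60 degrees, written as a graph over
  its first coordinate. The vectors \<open>p\<close>, \<open>q\<close>, \<open>p - q\<close> are the directions of the sides.
\<close>

lemma universal_cover_contains_triangle:
  assumes "universal_cover K"
  obtains A p q where "A \<in> K" "A + (1/2) *\<^sub>R p \<in> K" "A + (1/2) *\<^sub>R q \<in> K"
    "p \<bullet> p = 1" "q \<bullet> q = 1" "p \<bullet> q = 1/2"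
proof -
  define g :: "real \<Rightarrow> real^2" where "g t = vector [t / 2, sqrt 3 / 2 * \<bar>t - 1/2\<bar>]" for t
  obtain f where f: "isometry f" "\<And>t. 0 \<le> t \<Longrightarrow> t \<le> 1 \<Longrightarrow> f (g t) \<in> K"
  proof (rule universal_cover_contains_unit_speed_arc[OF assms, of g 2 "\<lambda>i. real i / 2"])
    show "dist (g s) (g t) \<le> t - s" if "s \<le> t" for s t
    proof (rule dist_vec2_le)
      have "(\<bar>s - 1/2\<bar> - \<bar>t - 1/2\<bar>)\<^sup>2 \<le> (t - s)\<^sup>2"
        using that by (intro abs_le_square_iff[THEN iffD1]) auto
      moreover have "(g s $ 1 - g t $ 1)\<^sup>2 = (t - s)\<^sup>2 / 4"
        by (simp add: g_def power2_eq_square field_simps)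
      moreover have "g s $ 2 - g t $ 2 = sqrt 3 / 2 * (\<bar>s - 1/2\<bar> - \<bar>t - 1/2\<bar>)"
        by (simp add: g_def algebra_simps)
      then have "(g s $ 2 - g t $ 2)\<^sup>2 = 3/4 * (\<bar>s - 1/2\<bar> - \<bar>t - 1/2\<bar>)\<^sup>2"
        by (simp only: power_mult_distrib power_divide) simp
      ultimately show "(g s $ 1 - g t $ 1)\<^sup>2 + (g s $ 2 - g t $ 2)\<^sup>2 \<le> (t - s)\<^sup>2"
        by simp
    qed (use that in auto)
    show "g s \<noteq> g t" if "s < t" for s t
      using that by (auto simp: g_def vec_eq_iff forall_2)
    show "(\<Sum>i<2. dist (g (real i / 2)) (g (real (Suc i) / 2))) = 1"
      by (simp add: g_def numeral_2_eq_2 dist_vec_def L2_set_def sum_2 dist_real_def power_divide real_sqrt_divide)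
  qed (auto simp: mono_on_def)
  define p q where "p = 2 *\<^sub>R (f (g 0) - f (g (1/2)))" and "q = 2 *\<^sub>R (f (g 1) - f (g (1/2)))"
  have "p \<bullet> p = 1" "q \<bullet> q = 1" "p \<bullet> q = 1/2"
    unfolding p_def q_def
    by (simp_all only: inner_scaleR_left inner_scaleR_right isometry_inner_diff[OF f(1)])
       (simp_all add: g_def inner_vec_def sum_2)
  then show ?thesis using f by (intro that[of "f (g (1/2))" p q]) (auto simp: p_def q_def)
qed

text \<open>
  The arc consists of three sides of a rectangle, of lengths \<open>1/4\<close>, \<open>1/2\<close>, \<open>1/4\<close>. The ratio
  of the sides gives the extent along the shorter one twice the weight of the other extent. For a
  square, the same estimates would leave almost no room when the segment forms an angle of about
  30 degrees with a side.
\<close>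

lemma universal_cover_contains_rectangle:
  assumes "universal_cover K"
  obtains P u v where "P \<in> K" "P + (1/2) *\<^sub>R u \<in> K" "P + (1/4) *\<^sub>R v \<in> K"
    "P + (1/2) *\<^sub>R u + (1/4) *\<^sub>R v \<in> K" "u \<bullet> u = 1" "v \<bullet> v = 1" "u \<bullet> v = 0"
proof -
  define g :: "real \<Rightarrow> real^2"
    where "g t = vector [max 0 (min (1/2) (t - 1/4)), max 0 (1/4 - t) + max 0 (t - 3/4)]" for t
  obtain f where f: "isometry f" "\<And>t. 0 \<le> t \<Longrightarrow> t \<le> 1 \<Longrightarrow> f (g t) \<in> K"
  proof (rule universal_cover_contains_unit_speed_arc[OF assms, of g 3
        "\<lambda>i. if i = 0 then 0 else if i = 1 then 1/4 else if i = 2 then 3/4 else 1"])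
    show "dist (g s) (g t) \<le> t - s" if "s \<le> t" for s t
    proof (rule dist_vec2_le)
      define x y where "x = \<bar>g s $ 1 - g t $ 1\<bar>" and "y = \<bar>g s $ 2 - g t $ 2\<bar>"
      have "x + y \<le> t - s"
      proof -
        \<comment> \<open>Each of the three legs of the arc contributes a monotone summand to the parameter, and
          the coordinates only recombine these summands.\<close>
        define d1 d2 d3 :: "real \<Rightarrow> real" where "d1 r = max 0 (1/4 - r)"
          and "d2 r = max 0 (min (1/2) (r - 1/4))" and "d3 r = max 0 (r - 3/4)" for r
        have "r = 1/4 - d1 r + d2 r + d3 r" for r
          by (auto simp: d1_def d2_def d3_def max_def min_def)
        from this[of s] this[of t]
        have "t - s = (d1 s - d1 t) + (d2 t - d2 s) + (d3 t - d3 s)" by argo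
        moreover have "d1 t \<le> d1 s" "d2 s \<le> d2 t" "d3 s \<le> d3 t"
          unfolding d1_def d2_def d3_def
          using that by (intro max.mono min.mono order_refl; simp)+
        moreover have "x = \<bar>d2 s - d2 t\<bar>" "y = \<bar>(d1 s + d3 s) - (d1 t + d3 t)\<bar>"
          by (simp_all only: x_def y_def g_def vector_2 d1_def d2_def d3_def)
        ultimately show ?thesis by linarith
      qed
      moreover have "0 \<le> x" "0 \<le> y" by (simp_all add: x_def y_def)
      ultimately have "(x + y)\<^sup>2 \<le> (t - s)\<^sup>2" by (intro power_mono) auto
      moreover have "x\<^sup>2 + y\<^sup>2 \<le> (x + y)\<^sup>2" using \<open>0 \<le> x\<close> \<open>0 \<le> y\<close> by (simp add: power2_sum)
      ultimately show "(g s $ 1 - g t $ 1)\<^sup>2 + (g s $ 2 - g t $ 2)\<^sup>2 \<le> (t - s)\<^sup>2"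
        by (simp add: x_def y_def)
    qed (use that in auto)
    show "g s \<noteq> g t" if "s < t" for s t
      using that by (auto simp: g_def vec_eq_iff forall_2 abs_if max_def min_def split: if_splits)
    let ?c = "\<lambda>i. if i = 0 then 0 else if i = 1 then 1/4 else if i = 2 then 3/4 else 1 :: real"
    have "dist (g 0) (g (1/4)) = 1/4" "dist (g (1/4)) (g (3/4)) = 1/2" "dist (g (3/4)) (g 1) = 1/4"
      by (simp_all add: g_def dist_vec_def L2_set_def sum_2 dist_real_def)
    then show "(\<Sum>i<3. dist (g (?c i)) (g (?c (Suc i)))) = 1"
      by (simp add: numeral_3_eq_3)
  qed (auto simp: mono_on_def)
  define P u v where "P = f (g (1/4))" and "u = 2 *\<^sub>R (f (g (3/4)) - P)"
    and "v = 4 *\<^sub>R (f (g 0) - P)"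
  have uv: "u \<bullet> u = 1" "v \<bullet> v = 1" "u \<bullet> v = 0"
    unfolding P_def u_def v_def
    by (simp_all only: inner_scaleR_left inner_scaleR_right isometry_inner_diff[OF f(1)])
       (simp_all add: g_def inner_vec_def sum_2)
  define d where "d = f (g 1) - P"
  have d: "d \<bullet> u = 1/2" "d \<bullet> v = 1/4" "d \<bullet> d = 5/16"
    unfolding P_def u_def v_def d_def
    by (simp_all only: inner_scaleR_left inner_scaleR_right isometry_inner_diff[OF f(1)])
       (simp_all add: g_def inner_vec_def sum_2)
  have "(d - (1/2) *\<^sub>R u - (1/4) *\<^sub>R v) \<bullet> (d - (1/2) *\<^sub>R u - (1/4) *\<^sub>R v) = 0"
    using uv d by (simp add: inner_diff inner_commute)
  then have "d - (1/2) *\<^sub>R u - (1/4) *\<^sub>R v = 0" by simp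
  then have "f (g 1) = P + (1/2) *\<^sub>R u + (1/4) *\<^sub>R v" by (simp add: d_def algebra_simps)
  then show ?thesis using f uv f(2)[of 1] f(2)[of 0] f(2)[of "1/4"] f(2)[of "3/4"]
    by (intro that[of P u v]) (auto simp: P_def u_def v_def)
qed

section \<open>Projections of an equilateral triangle\<close>

text \<open>
  The three side directions of an equilateral triangle project to \<open>x\<close>, \<open>y\<close>, \<open>x - y\<close> on any axis,
  and \<open>x\<^sup>2 - x * y + y\<^sup>2\<close> is invariant under rotations. This single equation replaces the
  angle of the triangle in the following estimates.
\<close>

lemma equilateral_projections:
  fixes p q n :: "real^2"
  assumes pq: "p \<bullet> p = 1" "q \<bullet> q = 1" "p \<bullet> q = 1/2" and n: "n \<bullet> n = 1"
  shows "(p \<bullet> n)\<^sup>2 - (p \<bullet> n) * (q \<bullet> n) + (q \<bullet> n)\<^sup>2 = 3/4"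
proof -
  define w where "w = (2 / sqrt 3) *\<^sub>R (q - (1/2) *\<^sub>R p)"
  have "w \<bullet> w = 1" "p \<bullet> w = 0"
    using pq by (simp_all add: w_def inner_diff inner_commute)
  then have "1 = (n \<bullet> p) * (n \<bullet> p) + (n \<bullet> w) * (n \<bullet> w)"
    using pq n inner_orthonormal_pair[of p w n n] by simp
  moreover have "n \<bullet> w = 2 / sqrt 3 * (n \<bullet> q - n \<bullet> p / 2)"
    by (simp add: w_def inner_diff_right)
  then have "(n \<bullet> w)\<^sup>2 = 4/3 * (n \<bullet> q - n \<bullet> p / 2)\<^sup>2"
    by (simp only: power_mult_distrib power_divide) simp
  ultimately have "(n \<bullet> p)\<^sup>2 + 4/3 * (n \<bullet> q - n \<bullet> p / 2)\<^sup>2 = 1"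
    by (simp add: power2_eq_square)
  then have "(n \<bullet> p)\<^sup>2 - (n \<bullet> p) * (n \<bullet> q) + (n \<bullet> q)\<^sup>2 = 3/4"
    by algebra
  then show ?thesis by (simp only: inner_commute[of n])
qed

text \<open>
  An equilateral triangle with unit sides has width at least its altitude \<open>sqrt 3 / 2 > 0.866\<close> in every
  direction: were all three projections shorter, the equation would make \<open>x * (x - y)\<close>,
  \<open>y * (y - x)\<close> and \<open>x * y\<close> positive, but no choice of signs allows this.
\<close>

lemma equilateral_max_ge:
  fixes x y :: real
  assumes "x\<^sup>2 - x * y + y\<^sup>2 = 3/4"
  shows "\<exists>z \<in> {x, y, x - y}. 433/500 \<le> \<bar>z\<bar>"
proof (rule ccontr)
  assume "\<not> ?thesis"
  then have *: "\<bar>x\<bar> < 433/500" "\<bar>y\<bar> < 433/500" "\<bar>x - y\<bar> < 433/500" by auto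
  have sq: "z\<^sup>2 < 3/4" if "\<bar>z\<bar> < 433/500" for z :: real
  proof -
    have "\<bar>z\<bar>\<^sup>2 < (433/500)\<^sup>2" using that by (intro power_strict_mono) auto
    then show ?thesis by (simp add: power2_eq_square)
  qed
  have "0 < x * (x - y)" "0 < y * (y - x)" "0 < x * y"
    using sq[OF *(1)] sq[OF *(2)] sq[OF *(3)] assms by (auto simp: power2_eq_square algebra_simps)
  then show False by (auto simp: zero_less_mult_iff)
qed

text \<open>
  If one side forms an angle between about 41 and 79 degrees with the axis, the width exceeds the
  altitude clearly: \<open>y\<close> and \<open>x - y\<close> are the roots of \<open>z\<^sup>2 - x * z + x\<^sup>2 - 3/4\<close>, which is not
  positive at \<open>z = 0.94\<close> for \<open>x\<close> in this range.
\<close>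

lemma equilateral_max_ge_if_tilted:
  fixes x y :: real
  assumes "x\<^sup>2 - x * y + y\<^sup>2 = 3/4" and x: "9/50 \<le> \<bar>x\<bar>" "\<bar>x\<bar> \<le> 19/25"
  shows "\<exists>z \<in> {y, x - y}. 47/50 \<le> \<bar>z\<bar>"
proof -
  have pos: "\<exists>z \<in> {b, a - b}. 47/50 \<le> \<bar>z\<bar>"
    if ab: "a\<^sup>2 - a * b + b\<^sup>2 = 3/4" and a: "9/50 \<le> a" "a \<le> 19/25" for a b :: real
  proof -
    have "(a - 9/50) * (a - 19/25) \<le> 0" using a by (simp add: mult_nonneg_nonpos)
    moreover have "(a - 9/50) * (a - 19/25) = a\<^sup>2 - 47/50 * a + 171/1250"
      by (simp add: power2_eq_square field_simps)
    moreover have "(47/50 - b) * (47/50 - (a - b)) = (a\<^sup>2 - 47/50 * a + 167/1250) - (a\<^sup>2 - a * b + b\<^sup>2 - 3/4)"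
      by (simp add: power2_eq_square field_simps)
    ultimately have "(47/50 - b) * (47/50 - (a - b)) \<le> 0" using ab a by linarith
    then show ?thesis by (auto simp: mult_le_0_iff)
  qed
  show ?thesis
  proof (cases "0 \<le> x")
    case True
    then show ?thesis using pos[of x y] assms by auto
  next
    case False
    then show ?thesis using pos[of "-x" "-y"] assms by (auto simp: abs_minus_commute)
  qed
qed

text \<open>
  Conversely, if the width is close to the altitude, some side is nearly orthogonal to the axis.
  The longest projection is the sum \<open>a + b\<close> of the two others, and \<open>a * b = (a + b)\<^sup>2 - 3/4\<close> is small.
\<close>

lemma equilateral_min_le:
  fixes x y :: real
  assumes xy: "x\<^sup>2 - x * y + y\<^sup>2 = 3/4"
    and *: "\<bar>x\<bar> < 91/100" "\<bar>y\<bar> < 91/100" "\<bar>x - y\<bar> < 91/100"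
  shows "\<exists>z \<in> {x, y, x - y}. \<bar>z\<bar> \<le> 1/10"
proof (rule ccontr)
  assume "\<not> ?thesis"
  then have g: "\<bar>x\<bar> > 1/10" "\<bar>y\<bar> > 1/10" "\<bar>x - y\<bar> > 1/10" by auto
  have key: False if ab: "1/10 < a" "1/10 < b" "a + b < 91/100" and id: "(a + b)\<^sup>2 - a * b = 3/4" for a b :: real
  proof -
    have "0 < (a - 1/10) * (b - 1/10)" using ab by simp
    also have "\<dots> = a * b - 1/10 * (a + b) + 1/100" by (simp add: field_simps)
    finally have "0 < (a + b)\<^sup>2 - 1/10 * (a + b) - 37/50" using id by linarith
    also have "\<dots> = (a + b) * (a + b - 1/10) - 37/50" by (simp add: power2_eq_square algebra_simps)
    also have "(a + b) * (a + b - 1/10) \<le> (91/100) * (81/100)" using ab by (intro mult_mono) auto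
    finally show False by simp
  qed
  consider "x > 0" "y > 0" "x > y" | "x > 0" "y > 0" "x < y" | "x < 0" "y < 0" "x > y" | "x < 0" "y < 0" "x < y"
    | "x > 0" "y < 0" | "x < 0" "y > 0"
  proof -
    have "x \<noteq> 0" "y \<noteq> 0" "x \<noteq> y" using g by auto
    then show thesis using that by (meson linorder_neqE_linordered_idom)
  qed
  then show False
  proof cases
    case 1 show ?thesis by (rule key[of "y" "x - y"]) (use 1 g * xy in \<open>auto simp: power2_eq_square algebra_simps\<close>)
  next
    case 2 show ?thesis by (rule key[of "x" "y - x"]) (use 2 g * xy in \<open>auto simp: power2_eq_square algebra_simps\<close>)
  next
    case 3 show ?thesis by (rule key[of "-x" "x - y"]) (use 3 g * xy in \<open>auto simp: power2_eq_square algebra_simps\<close>)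
  next
    case 4 show ?thesis by (rule key[of "-y" "y - x"]) (use 4 g * xy in \<open>auto simp: power2_eq_square algebra_simps\<close>)
  next
    case 5 show ?thesis by (rule key[of "x" "-y"]) (use 5 g * xy in \<open>auto simp: power2_eq_square algebra_simps\<close>)
  next
    case 6 show ?thesis by (rule key[of "-x" "y"]) (use 6 g * xy in \<open>auto simp: power2_eq_square algebra_simps\<close>)
  qed
qed

section \<open>Combining the three arcs\<close>

text \<open>
  If the bound failed, \<open>c \<ge> 0\<close> would force \<open>s \<le> 0.91\<close>, and \<open>c\<^sup>2 = 1 - s\<^sup>2\<close> would make
  \<open>5 * s\<^sup>2 - 7.28 * s + 2.3124\<close> positive; but the roots of this quadratic enclose the
  interval from \<open>0.47\<close> to \<open>0.91\<close>.
\<close>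

lemma sum_2sin_cos_ge:
  fixes s c :: real
  assumes "s\<^sup>2 + c\<^sup>2 = 1" "0 \<le> c" "47/100 \<le> s"
  shows "91/50 \<le> 2 * s + c"
proof (rule ccontr)
  assume "\<not> ?thesis"
  then have lt: "c < 91/50 - 2 * s" by simp
  then have "c\<^sup>2 < (91/50 - 2 * s)\<^sup>2" using assms by (intro power_strict_mono) auto
  moreover have "(s - 47/100) * (s - 91/100) \<le> 0" using assms lt by (simp add: mult_nonneg_nonpos)
  ultimately show False using assms by (simp add: power2_eq_square algebra_simps)
qed

text \<open>
  Let \<open>\<theta>\<close> be the angle between the segment direction \<open>e\<close> and the axis \<open>u\<close>, and let the side \<open>t\<close>
  of the triangle be nearly parallel to the segment. For large \<open>\<theta>\<close> the segment alone extends far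
  enough along \<open>v\<close>. For small \<open>\<theta>\<close> it is long along \<open>u\<close>, and the least possible width
  of the triangle suffices along \<open>v\<close>. In between, the side \<open>t\<close> is forced to be tilted against
  \<open>u\<close>, and the triangle is therefore wider along \<open>v\<close>.
\<close>

lemma segment_and_aligned_triangle_not_narrow:
  fixes u v e n t r :: "real^2"
  assumes uv: "u \<bullet> u = 1" "v \<bullet> v = 1" "u \<bullet> v = 0" and e: "e \<bullet> e = 1" "n \<bullet> n = 1" "e \<bullet> n = 0"
    and tr: "t \<bullet> t = 1" "r \<bullet> r = 1" "t \<bullet> r = 1/2"
    and tilt: "\<bar>t \<bullet> n\<bar> \<le> 1/10"
    and he: "2 * \<bar>e \<bullet> v\<bar> + \<bar>e \<bullet> u\<bar> < 91/50"
    and hs: "\<And>d. d \<in> {t, r, t - r} \<Longrightarrow> \<bar>d \<bullet> v\<bar> + \<bar>e \<bullet> u\<bar> < 91/50"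
  shows False
proof -
  define s c where "s = \<bar>e \<bullet> v\<bar>" and "c = \<bar>e \<bullet> u\<bar>"
  have sc: "s\<^sup>2 + c\<^sup>2 = 1" "0 \<le> s" "0 \<le> c"
    using inner_orthonormal_pair[OF uv, of e e] e by (auto simp: s_def c_def power2_eq_square)
  have eq: "(t \<bullet> v)\<^sup>2 - (t \<bullet> v) * (r \<bullet> v) + (r \<bullet> v)\<^sup>2 = 3/4"
    using equilateral_projections[OF tr uv(2)] .
  have s: "s < 47/100"
  proof (rule ccontr)
    assume "\<not> s < 47/100"
    then have "91/50 \<le> 2 * s + c" using sc by (intro sum_2sin_cos_ge) auto
    then show False using he unfolding s_def c_def by simp
  qed
  then have "s\<^sup>2 < (47/100)\<^sup>2" using sc by (intro power_strict_mono) auto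
  then have "(4413/5000)\<^sup>2 < c\<^sup>2" using sc by (simp add: power2_eq_square)
  then have c: "4413/5000 < c" using sc by (metis power2_less_imp_less)
  show False
  proof (cases "477/500 \<le> c")
    case True
    from equilateral_max_ge[OF eq] obtain d where "d \<in> {t, r, t - r}" "433/500 \<le> \<bar>d \<bullet> v\<bar>"
      by (fastforce simp: inner_diff_left)
    then show False using hs[of d] True unfolding c_def by linarith
  next
    case False
    then have "c\<^sup>2 < (477/500)\<^sup>2" using sc by (intro power_strict_mono) auto
    then have "(1499/5000)\<^sup>2 < s\<^sup>2" using sc by (simp add: power2_eq_square)
    then have s': "1499/5000 < s" using sc by (metis power2_less_imp_less)
    have "(t \<bullet> e)\<^sup>2 + (t \<bullet> n)\<^sup>2 = 1"
      using inner_orthonormal_pair[OF e, of t t] tr by (simp add: power2_eq_square)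
    moreover have "(t \<bullet> n)\<^sup>2 \<le> 1/100"
      using power_mono[OF tilt, of 2] by (simp add: power2_eq_square)
    ultimately have te: "99/100 \<le> (t \<bullet> e)\<^sup>2" "(t \<bullet> e)\<^sup>2 \<le> 1"
      using zero_le_power2[of "t \<bullet> n"] by linarith+
    have "(99/100)\<^sup>2 \<le> \<bar>t \<bullet> e\<bar>\<^sup>2" using te(1) by (simp add: power2_eq_square)
    then have te': "99/100 \<le> \<bar>t \<bullet> e\<bar>" by (rule power2_le_imp_le) simp
    have te'': "\<bar>t \<bullet> e\<bar> \<le> 1" using te(2) by (simp add: abs_square_le_1)
    have "(n \<bullet> v)\<^sup>2 + (e \<bullet> v)\<^sup>2 = 1"
      using inner_orthonormal_pair[OF e, of v v] uv by (simp add: power2_eq_square inner_commute)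
    then have "\<bar>n \<bullet> v\<bar>\<^sup>2 = c\<^sup>2" using sc(1) by (simp add: s_def)
    then have nv: "\<bar>n \<bullet> v\<bar> = c" using sc(3) by (metis abs_ge_zero power2_eq_iff_nonneg)
    have tv: "t \<bullet> v = (t \<bullet> e) * (e \<bullet> v) + (t \<bullet> n) * (n \<bullet> v)"
      using inner_orthonormal_pair[OF e, of t v] by (simp add: inner_commute)
    have main: "\<bar>(t \<bullet> e) * (e \<bullet> v)\<bar> \<ge> 99/100 * s" "\<bar>(t \<bullet> e) * (e \<bullet> v)\<bar> \<le> 1 * s"
      unfolding abs_mult s_def by (intro mult_right_mono te' te'' abs_ge_zero)+
    have small: "\<bar>(t \<bullet> n) * (n \<bullet> v)\<bar> \<le> 1/10 * c"
      unfolding abs_mult nv using tilt sc by (intro mult_right_mono)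
    have "9/50 \<le> \<bar>t \<bullet> v\<bar>" "\<bar>t \<bullet> v\<bar> \<le> 19/25"
      using main small s s' False unfolding tv by linarith+
    from equilateral_max_ge_if_tilted[OF eq this] obtain d where "d \<in> {t, r, t - r}" "47/50 \<le> \<bar>d \<bullet> v\<bar>"
      by (fastforce simp: inner_diff_left)
    then show False using hs[of d] c unfolding c_def by linarith
  qed
qed

theorem theorem2:
  fixes K :: "(real^2) set"
  assumes "convex K" and "universal_cover K"
  shows "emeasure lebesgue K \<ge> ennreal 0.227498"
proof -
  obtain Q E where seg: "Q \<in> K" "E \<in> K" and e1: "(E - Q) \<bullet> (E - Q) = 1"
    using universal_cover_contains_segment[OF assms(2)] .
  obtain A p q where tri: "A \<in> K" "A + (1/2) *\<^sub>R p \<in> K" "A + (1/2) *\<^sub>R q \<in> K"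
    and pq: "p \<bullet> p = 1" "q \<bullet> q = 1" "p \<bullet> q = 1/2"
    using universal_cover_contains_triangle[OF assms(2)] .
  obtain P u v where rect: "P \<in> K" "P + (1/2) *\<^sub>R u \<in> K" "P + (1/4) *\<^sub>R v \<in> K"
    "P + (1/2) *\<^sub>R u + (1/4) *\<^sub>R v \<in> K" and uv: "u \<bullet> u = 1" "v \<bullet> v = 1" "u \<bullet> v = 0"
    using universal_cover_contains_rectangle[OF assms(2)] .
  define F where "F = {Q, E, A, A + (1/2) *\<^sub>R p, A + (1/2) *\<^sub>R q, P, P + (1/2) *\<^sub>R u,
    P + (1/4) *\<^sub>R v, P + (1/2) *\<^sub>R u + (1/4) *\<^sub>R v}"
  define m where "m = measure lebesgue (convex hull F)"
  have F: "finite F" "F \<subseteq> K" using seg tri rect by (auto simp: F_def)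
  define e where "e = E - Q"
  define D where "D = {x - y | x y. x \<in> F \<and> y \<in> F}"
  have D_neg: "- d \<in> D" if "d \<in> D" for d
    using that unfolding D_def by (smt (verit) mem_Collect_eq minus_diff_eq)
  have D_e: "e \<in> D" unfolding D_def e_def
    by (intro CollectI exI[of _ E] exI[of _ Q]) (simp add: F_def)
  have side: "(1/2) *\<^sub>R d \<in> D" if "d \<in> {p, q, p - q}" for d
  proof -
    have D_I: "x - y \<in> D" if "x \<in> F" "y \<in> F" for x y using that by (auto simp: D_def)
    have AF: "A \<in> F" "A + (1/2) *\<^sub>R p \<in> F" "A + (1/2) *\<^sub>R q \<in> F"
      by (simp_all add: F_def)
    have "(1/2) *\<^sub>R p \<in> D" "(1/2) *\<^sub>R q \<in> D" "(1/2) *\<^sub>R (p - q) \<in> D"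
      using D_I[OF AF(2,1)] D_I[OF AF(3,1)] D_I[OF AF(2,3)] by (simp_all add: scaleR_diff_right)
    then show ?thesis using that by blast
  qed
  have rect_bound: "(1/2) * (d \<bullet> v) + (1/4) * (d' \<bullet> u) \<le> 2 * m" if "d \<in> D" "d' \<in> D" for d d'
  proof -
    have "P \<in> F" "P + (1/2) *\<^sub>R u \<in> F" "P + (1/4) *\<^sub>R v \<in> F"
      "P + (1/2) *\<^sub>R u + (1/4) *\<^sub>R v \<in> F"
      by (simp_all add: F_def)
    with that show ?thesis
      using mixed_area_bound[OF uv _ _ F(1), of "1/2" "1/4" P] unfolding m_def D_def by auto
  qed
  have rect_abs: "(1/2) * \<bar>d \<bullet> v\<bar> + (1/4) * \<bar>d' \<bullet> u\<bar> \<le> 2 * m" if "d \<in> D" "d' \<in> D" for d d'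
    using rect_bound[OF that] rect_bound[OF D_neg[OF that(1)] that(2)]
      rect_bound[OF that(1) D_neg[OF that(2)]] rect_bound[OF D_neg[OF that(1)] D_neg[OF that(2)]]
    by (auto simp: abs_if)
  \<comment> \<open>The direction \<open>e\<close> of the segment, rotated by a right angle.\<close>
  define n where "n = (- (e \<bullet> v)) *\<^sub>R u + (e \<bullet> u) *\<^sub>R v"
  have vu: "v \<bullet> u = 0" using uv by (simp add: inner_commute)
  have e: "e \<bullet> e = 1" "n \<bullet> n = 1" "e \<bullet> n = 0"
  proof -
    show "e \<bullet> e = 1" using e1 by (simp add: e_def)
    then have "(e \<bullet> u) * (e \<bullet> u) + (e \<bullet> v) * (e \<bullet> v) = 1"
      using inner_orthonormal_pair[OF uv, of e e] by simp
    moreover have nuv: "n \<bullet> u = - (e \<bullet> v)" "n \<bullet> v = e \<bullet> u" by (simp_all add: n_def inner_diff inner_add uv vu)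
    ultimately show "n \<bullet> n = 1" using inner_orthonormal_pair[OF uv, of n n] by simp
    show "e \<bullet> n = 0" using inner_orthonormal_pair[OF uv, of e n] nuv by simp
  qed
  \<comment> \<open>The segment as a degenerate rectangle bounds the extent orthogonal to the segment.\<close>
  have seg_bound: "d \<bullet> n \<le> 2 * m" if "d \<in> D" for d
  proof -
    have "Q + e = E" by (simp add: e_def)
    moreover have "Q \<in> F" "E \<in> F" by (simp_all add: F_def)
    ultimately show ?thesis
      using that mixed_area_bound[OF e _ _ F(1), of 1 0 Q] unfolding m_def D_def by auto
  qed
  have seg_abs: "\<bar>d \<bullet> n\<bar> \<le> 4 * m" if "d \<in> {p, q, p - q}" for d
    using seg_bound[OF side[OF that]] seg_bound[OF D_neg[OF side[OF that]]] by auto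
  have "0.227498 \<le> m"
  proof (rule ccontr)
    assume "\<not> ?thesis"
    then have small: "m < 0.227498" by simp
    have he: "2 * \<bar>e \<bullet> v\<bar> + \<bar>e \<bullet> u\<bar> < 91/50"
      using rect_abs[OF D_e D_e] small by simp
    have hs: "\<bar>d \<bullet> v\<bar> + \<bar>e \<bullet> u\<bar> < 91/50" if "d \<in> {p, q, p - q}" for d
      using rect_abs[OF side[OF that] D_e] small by (simp add: abs_mult)
    \<comment> \<open>The extent of the triangle orthogonal to the segment is too small unless one of its sides is
      nearly parallel to the segment.\<close>
    have "\<exists>z \<in> {p \<bullet> n, q \<bullet> n, p \<bullet> n - q \<bullet> n}. \<bar>z\<bar> \<le> 1/10"
      using seg_abs[of p] seg_abs[of q] seg_abs[of "p - q"] small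
      by (intro equilateral_min_le equilateral_projections pq e) (auto simp: inner_diff_left)
    then consider "\<bar>p \<bullet> n\<bar> \<le> 1/10" | "\<bar>q \<bullet> n\<bar> \<le> 1/10" | "\<bar>(p - q) \<bullet> n\<bar> \<le> 1/10"
      by (auto simp: inner_diff_left)
    then show False
    proof cases
      case 1
      show ?thesis
        by (rule segment_and_aligned_triangle_not_narrow[OF uv e pq 1 he hs]) auto
    next
      case 2
      have "\<bar>d \<bullet> v\<bar> + \<bar>e \<bullet> u\<bar> < 91/50" if "d \<in> {q, p, q - p}" for d
        using that hs[of d] hs[of "-d"] by auto
      then show ?thesis
        using segment_and_aligned_triangle_not_narrow[OF uv e pq(2,1) _ 2 he] pq(3) by (simp add: inner_commute)
    next
      case 3
      have "\<bar>d \<bullet> v\<bar> + \<bar>e \<bullet> u\<bar> < 91/50" if "d \<in> {p - q, p, (p - q) - p}" for d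
        using that hs[of d] hs[of "-d"] by auto
      moreover have "(p - q) \<bullet> (p - q) = 1" "(p - q) \<bullet> p = 1/2"
        using pq by (simp_all add: inner_diff inner_commute)
      ultimately show ?thesis
        using segment_and_aligned_triangle_not_narrow[OF uv e _ pq(1) _ 3 he] by blast
    qed
  qed
  then have "ennreal 0.227498 \<le> ennreal m" by (rule ennreal_leI)
  also have "\<dots> \<le> emeasure lebesgue K"
    unfolding m_def using assms(1) F by (rule emeasure_convex_ge_hull)
  finally show ?thesis .
qed

end
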